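(* Consider the uncertain-horizon (randomly-terminated) problem on a finite directed graph with nodes $X=\{x_1,\dots,x_M\}$, termination probability $p\in(0,1)$, transition costs $K_{ij}$ and terminal costs $q_i$. Assume that (A1) $x_i\in N(x_i)$ for every $x_i\in X$; (A2) $K_{ii}=0$ for every $i$; (A3) there is a constant $\Delta\ge 0$ with $K_{ij}\ge\Delta$ for all $i$ and all $j\ne i$. Then: 1. $V_i\le q_i$ for all $x_i\in X$. 2. If $\mathbf{y}=(y_0,y_1,\dots)$ is an optimal simple path starting from $x_i$ and $y_k=x_j$, then $V_i\ge k\Delta+V_j$. 3. If a loop $(y_0,\dots,y_m)$, i.e. a periodic path which repeatedly visits $y_0,y_1,\dots,y_m$ in this order, is an optimal path, then $V(y_k)=q(y_k)=q(y_0)$ for all $k=0,\dots,m$. 4. For every $x\in X$ there exists an optimal path starting from $x$ that is simple and eventually motionless. 5. If an eventually motionless optimal path from $x$ leads through a node $\tilde x\ne x$, then there exists an eventually motionless optimal path from $\tilde x$ that avoids $x$.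
   Context: $N(x_i)\subset X$ is the set of nodes to which a direct transition from $x_i$ is possible. A transition from $x_i$ to $x_j\in N(x_i)$ has real cost $K_{ij}=K(x_i,x_j)$ (and $K_{ij}=+\infty$ if $x_j\notin N(x_i)$); $q_i=q(x_i)\in\mathbb{R}$ is the terminal cost at $x_i$. A path is an infinite sequence $\mathbf{y}=(y_0,y_1,\dots)$ of nodes with $y_{k+1}\in N(y_k)$ for all $k\ge0$. The process terminates with probability $p$ after each transition, so it terminates after exactly $t\ge1$ steps with probability $(1-p)^{t-1}p$. For a finite path, $Cost(y_0,\dots,y_t)=\sum_{k=0}^{t-1}K(y_k,y_{k+1})+q(y_t)$. The expected cost of a path is $J(\mathbf{y})=\sum_{t=1}^\infty (1-p)^{t-1}p\,Cost(y_0,\dots,y_t)$, and the value function is $V_i=V(x_i)=\min J(\mathbf{y})$ over all paths with $y_0=x_i$. A path from $x$ is optimal if $J(\mathbf{y})=V(x)$. A path is simple if $y_k=y_m$ implies $y_{k+1}=y_{m+1}$. A path is eventually motionless if there is $m\ge0$ with $y_k=y_m$ for all $k\ge m$.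
   Formalization: Item 2 is proved for all k if Δ = 0, and for Δ > 0 only when the path has not come to rest before step k (y_{l+1} ≠ y_l for all l < k); as stated it fails for an optimal motionless path, where V_i ≥ kΔ + V_i is false for k ≥ 1. *)

theory Defs
  imports Complex_Main
begin

text \<open>
  The graph has vertex set \<open>X\<close>; \<open>N x\<close> is the set of nodes to which a direct transition from \<open>x\<close> is
  possible. \<open>K x y\<close> is the transition cost for \<open>y \<in> N x\<close>. The convention that the cost is \<open>+\<infinity>\<close> for
  \<open>y \<notin> N x\<close> is expressed by never using \<open>K x y\<close> for such \<open>y\<close>: paths only follow direct transitions,
  and a lower bound on all costs is only required for \<open>y \<in> N x\<close>.
\<close>

definition is_path :: "'a set \<Rightarrow> ('a \<Rightarrow> 'a set) \<Rightarrow> (nat \<Rightarrow> 'a) \<Rightarrow> bool" where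
  "is_path X N y \<longleftrightarrow> (\<forall>k. y k \<in> X \<and> y (Suc k) \<in> N (y k))"

definition paths_from :: "'a set \<Rightarrow> ('a \<Rightarrow> 'a set) \<Rightarrow> 'a \<Rightarrow> (nat \<Rightarrow> 'a) set" where
  "paths_from X N x = {y. is_path X N y \<and> y 0 = x}"

text \<open>Cost of the finite path \<open>y 0, \<dots>, y t\<close>.\<close>

definition path_cost :: "('a \<Rightarrow> 'a \<Rightarrow> real) \<Rightarrow> ('a \<Rightarrow> real) \<Rightarrow> (nat \<Rightarrow> 'a) \<Rightarrow> nat \<Rightarrow> real" where
  "path_cost K q y t = (\<Sum>k<t. K (y k) (y (Suc k))) + q (y t)"

text \<open>
  The number of steps is at least 1, so the summation index is shifted: index \<open>t\<close> stands for
  termination after exactly \<open>Suc t\<close> steps. On a finite graph with \<open>0 < p < 1\<close> the costs grow at most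
  linearly in \<open>t\<close>, so the series converges absolutely for every path.
\<close>

definition expected_cost ::
  "real \<Rightarrow> ('a \<Rightarrow> 'a \<Rightarrow> real) \<Rightarrow> ('a \<Rightarrow> real) \<Rightarrow> (nat \<Rightarrow> 'a) \<Rightarrow> real" where
  "expected_cost p K q y = (\<Sum>t. (1 - p) ^ t * p * path_cost K q y (Suc t))"

text \<open>
  The value function is written as an infimum; that it is a minimum is the existence of an optimal
  path. On a finite graph in which every node has a successor, the infimum is over a nonempty set
  that is bounded below.
\<close>

definition value_fn ::
  "'a set \<Rightarrow> ('a \<Rightarrow> 'a set) \<Rightarrow> real \<Rightarrow> ('a \<Rightarrow> 'a \<Rightarrow> real) \<Rightarrow> ('a \<Rightarrow> real) \<Rightarrow> 'a \<Rightarrow> real" where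
  "value_fn X N p K q x = (INF y \<in> paths_from X N x. expected_cost p K q y)"

definition optimal_path ::
  "'a set \<Rightarrow> ('a \<Rightarrow> 'a set) \<Rightarrow> real \<Rightarrow> ('a \<Rightarrow> 'a \<Rightarrow> real) \<Rightarrow> ('a \<Rightarrow> real) \<Rightarrow> 'a \<Rightarrow> (nat \<Rightarrow> 'a) \<Rightarrow> bool"
  where
  "optimal_path X N p K q x y \<longleftrightarrow>
     y \<in> paths_from X N x \<and> expected_cost p K q y = value_fn X N p K q x"

definition simple_path :: "(nat \<Rightarrow> 'a) \<Rightarrow> bool" where
  "simple_path y \<longleftrightarrow> (\<forall>k m. y k = y m \<longrightarrow> y (Suc k) = y (Suc m))"

definition eventually_motionless :: "(nat \<Rightarrow> 'a) \<Rightarrow> bool" where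
  "eventually_motionless y \<longleftrightarrow> (\<exists>m. \<forall>k\<ge>m. y k = y m)"

text \<open>The loop \<open>(y 0, \<dots>, y m)\<close>, whose nodes need not be distinct, has \<open>Suc m\<close> entries per period.\<close>

definition is_loop :: "(nat \<Rightarrow> 'a) \<Rightarrow> nat \<Rightarrow> bool" where
  "is_loop y m \<longleftrightarrow> (\<forall>n. y (n + Suc m) = y n)"

end

theory Submission imports Defs begin

text \<open>
  Discarding the first step of a path gives
  \<open>J y = K (y 0) (y 1) + p * q (y 1) + (1 - p) * J (y \<circ> Suc)\<close>, hence a Bellman equation for the value
  function \<open>V\<close>, and tails of optimal paths are optimal. Since \<open>V \<le> q\<close> (staying put costs \<open>q\<close>), the
  Bellman equation yields \<open>V (y k) \<ge> K (y k) (y (Suc k)) + V (y (Suc k))\<close> along an optimal path, and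
  \<open>V\<close> can only stay constant on a step that ends in a node with \<open>V = q\<close>, where stopping is optimal.
  Following an optimal successor, and staying put wherever \<open>V = q\<close>, gives a simple optimal path. It
  revisits a node, \<open>V\<close> is constant between the two visits, and so the path stops there.
\<close>

locale random_termination =
  fixes X :: "'a set" and N :: "'a \<Rightarrow> 'a set"
    and K :: "'a \<Rightarrow> 'a \<Rightarrow> real" and q :: "'a \<Rightarrow> real" and p :: real
  assumes finite_nodes: "finite X"
    and neighbours: "\<And>x. x \<in> X \<Longrightarrow> N x \<subseteq> X"
    and p_pos: "0 < p" and p_less_1: "p < 1"
    and self_neighbour: "\<And>x. x \<in> X \<Longrightarrow> x \<in> N x"
    and K_self: "\<And>x. x \<in> X \<Longrightarrow> K x x = 0"
    and K_nonneg: "\<And>x u. x \<in> X \<Longrightarrow> u \<in> N x \<Longrightarrow> 0 \<le> K x u"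
begin

abbreviation "J \<equiv> expected_cost p K q"
abbreviation "V \<equiv> value_fn X N p K q"
abbreviation "optimal \<equiv> optimal_path X N p K q"

text \<open>Moving to \<open>u\<close>, then terminating there with probability \<open>p\<close> or
  continuing optimally: the right-hand side of the Bellman equation.\<close>

definition step_value :: "'a \<Rightarrow> 'a \<Rightarrow> real" where
  "step_value x u = K x u + p * q u + (1 - p) * V u"

section \<open>Paths and their expected cost\<close>

lemma paths_fromD:
  assumes "y \<in> paths_from X N x"
  shows "y 0 = x" "y k \<in> X" "y (Suc k) \<in> N (y k)"
  using assms by (auto simp: paths_from_def is_path_def)

lemma tail_in_paths_from:
  "y \<in> paths_from X N x \<Longrightarrow> y \<circ> Suc \<in> paths_from X N (y 1)"
  by (auto simp: paths_from_def is_path_def)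

lemma cons_in_paths_from:
  assumes "x \<in> X" "u \<in> N x" "y \<in> paths_from X N u"
  shows "case_nat x y \<in> paths_from X N x"
  using assms by (auto simp: paths_from_def is_path_def split: nat.split)

lemma const_in_paths_from: "x \<in> X \<Longrightarrow> (\<lambda>_. x) \<in> paths_from X N x"
  using self_neighbour by (auto simp: paths_from_def is_path_def)

text \<open>Path costs grow at most linearly, and the series of
  \<open>real (Suc t) * (1 - p) ^ t\<close> is the derivative of the geometric series.\<close>

lemma summable_expected_cost:
  assumes "y \<in> paths_from X N x"
  shows "summable (\<lambda>t. (1 - p) ^ t * p * path_cost K q y (Suc t))"
proof -
  \<comment> \<open>One constant bounds the costs of all pairs of nodes, edges or not; the inserted
    0 gives \<open>0 \<le> M\<close>.\<close>
  define M where "M = Max (insert 0 ((\<lambda>(u, v). \<bar>K u v\<bar>) ` (X \<times> X) \<union> (\<lambda>u. \<bar>q u\<bar>) ` X))"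
  have M0: "0 \<le> M" and MK: "\<bar>K u v\<bar> \<le> M" and Mq: "\<bar>q u\<bar> \<le> M" if "u \<in> X" "v \<in> X" for u v
    unfolding M_def using that finite_nodes by (auto intro!: Max_ge)
  have y: "y k \<in> X" for k using paths_fromD[OF assms] by blast
  have M_nonneg: "0 \<le> M" using M0 y by blast
  have bound: "\<bar>path_cost K q y (Suc t)\<bar> \<le> 2 * M * real (Suc t)" for t
  proof -
    have "\<bar>\<Sum>k<Suc t. K (y k) (y (Suc k))\<bar> \<le> (\<Sum>k<Suc t. \<bar>K (y k) (y (Suc k))\<bar>)"
      by (rule sum_abs)
    also have "\<dots> \<le> (\<Sum>k<Suc t. M)" by (intro sum_mono MK y)
    also have "\<dots> = real (Suc t) * M" by simp
    finally have "\<bar>path_cost K q y (Suc t)\<bar> \<le> real (Suc t) * M + M"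
      using Mq[OF y y, of "Suc t"] unfolding path_cost_def by linarith
    \<comment> \<open>The terminal cost is absorbed into the linear term, whence the factor
      2.\<close>
    moreover have "M \<le> real (Suc t) * M"
      using M_nonneg mult_right_mono[of 1 "real (Suc t)" M] by simp
    ultimately show ?thesis by (simp add: algebra_simps)
  qed
  have "summable (\<lambda>t. 2 * M * p * (real (Suc t) * (1 - p) ^ t))"
    using geometric_deriv_sums[of "1 - p"] p_pos p_less_1
    by (intro summable_mult sums_summable[of _ "1 / (1 - (1 - p))\<^sup>2"]) auto
  then show ?thesis
  proof (rule summable_comparison_test'[where N = 0])
    fix t
    have "norm ((1 - p) ^ t * p * path_cost K q y (Suc t))
        = (1 - p) ^ t * p * \<bar>path_cost K q y (Suc t)\<bar>"
      using p_pos p_less_1 by (simp add: abs_mult)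
    also have "\<dots> \<le> (1 - p) ^ t * p * (2 * M * real (Suc t))"
      using p_pos p_less_1 by (intro mult_left_mono bound) auto
    finally show "norm ((1 - p) ^ t * p * path_cost K q y (Suc t))
        \<le> 2 * M * p * (real (Suc t) * (1 - p) ^ t)"
      by (simp only: mult_ac)
  qed
qed

lemma termination_probability_sums: "(\<lambda>t. (1 - p) ^ t * p * c) sums c"
proof -
  have "(\<lambda>t. (1 - p) ^ t) sums (1 / p)"
    using geometric_sums[of "1 - p"] p_pos p_less_1 by simp
  from sums_mult2[OF this, of "p * c"] show ?thesis
    using p_pos by (simp add: mult_ac)
qed

lemma expected_cost_step:
  assumes "y \<in> paths_from X N x"
  shows "J y = K x (y 1) + p * q (y 1) + (1 - p) * J (y \<circ> Suc)"
proof -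
  let ?y = "y \<circ> Suc"
  \<comment> \<open>The cost of the tail is taken at \<open>t\<close>, not \<open>Suc t\<close>:
    index 0 is termination at \<open>y 1\<close>, right after the first transition, and the later
    terms form \<open>(1 - p) * J ?y\<close>.\<close>
  let ?f = "\<lambda>t. (1 - p) ^ t * p * path_cost K q ?y t"
  have "(\<lambda>t. (1 - p) ^ t * p * path_cost K q ?y (Suc t)) sums J ?y"
    unfolding expected_cost_def
    by (rule summable_sums[OF summable_expected_cost[OF tail_in_paths_from[OF assms]]])
  then have "(\<lambda>t. ?f (Suc t)) sums ((1 - p) * J ?y)"
    by (auto dest: sums_mult[of _ _ "1 - p"] simp: mult_ac)
  then have "?f sums ((1 - p) * J ?y + ?f 0)"
    by (rule sums_Suc)
  from sums_add[OF termination_probability_sums[of "K x (y 1)"] this]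
  have "(\<lambda>t. (1 - p) ^ t * p * (K x (y 1) + path_cost K q ?y t))
      sums (K x (y 1) + ((1 - p) * J ?y + p * q (y 1)))"
    by (simp add: algebra_simps path_cost_def)
  moreover have "path_cost K q y (Suc t) = K x (y 1) + path_cost K q ?y t" for t
    unfolding path_cost_def sum.lessThan_Suc_shift using paths_fromD(1)[OF assms] by simp
  ultimately show ?thesis
    unfolding expected_cost_def by (simp add: sums_iff add_ac)
qed

lemma expected_cost_const: "x \<in> X \<Longrightarrow> J (\<lambda>_. x) = q x"
  using termination_probability_sums[of "q x"] K_self
  by (simp add: expected_cost_def path_cost_def sums_iff)

text \<open>Makes the infimum in \<open>V\<close> bounded below: transition costs are nonnegative,
  so only the terminal cost can be negative.\<close>

lemma expected_cost_ge_Min: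
  assumes "y \<in> paths_from X N x"
  shows "Min (q ` X) \<le> J y"
proof -
  have y: "y k \<in> X" "y (Suc k) \<in> N (y k)" for k using paths_fromD[OF assms] by auto
  have "Min (q ` X) \<le> path_cost K q y (Suc t)" for t
  proof -
    have "0 \<le> (\<Sum>k<Suc t. K (y k) (y (Suc k)))" by (intro sum_nonneg K_nonneg y)
    moreover have "Min (q ` X) \<le> q (y (Suc t))" using finite_nodes y by (intro Min_le) auto
    ultimately show ?thesis unfolding path_cost_def by linarith
  qed
  then have "(1 - p) ^ t * p * Min (q ` X) \<le> (1 - p) ^ t * p * path_cost K q y (Suc t)" for t
    using p_pos p_less_1 by (intro mult_left_mono) auto
  then show ?thesis
    unfolding expected_cost_def
    by (rule sums_le[OF _ termination_probability_sums
          summable_sums[OF summable_expected_cost[OF assms]]])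
qed

section \<open>The value function and the Bellman equation\<close>

lemma value_le: "y \<in> paths_from X N x \<Longrightarrow> V x \<le> J y"
  unfolding value_fn_def using expected_cost_ge_Min
  by (intro cINF_lower bdd_belowI2[where m = "Min (q ` X)"]) auto

lemma value_greatest:
  assumes "x \<in> X" "\<And>y. y \<in> paths_from X N x \<Longrightarrow> c \<le> J y"
  shows "c \<le> V x"
  unfolding value_fn_def using assms const_in_paths_from by (intro cINF_greatest) auto

lemma value_le_terminal: "x \<in> X \<Longrightarrow> V x \<le> q x"
  using value_le[OF const_in_paths_from] expected_cost_const by metis

lemma value_le_step:
  assumes "x \<in> X" "u \<in> N x"
  shows "V x \<le> step_value x u"
proof -
  \<comment> \<open>Solved for \<open>V u\<close>, the claim becomes a lower bound on
    \<open>J y\<close> for all paths \<open>y\<close> from \<open>u\<close>; prepending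
    \<open>x\<close> to \<open>y\<close> proves it.\<close>
  have "(V x - K x u - p * q u) / (1 - p) \<le> V u"
  proof (rule value_greatest)
    show "u \<in> X" using assms neighbours by blast
    fix y assume y: "y \<in> paths_from X N u"
    let ?w = "case_nat x y"
    have w: "?w \<in> paths_from X N x" using cons_in_paths_from assms y by blast
    have "?w \<circ> Suc = y" by auto
    then have "J ?w = K x u + p * q u + (1 - p) * J y"
      using expected_cost_step[OF w] paths_fromD(1)[OF y] by simp
    then show "(V x - K x u - p * q u) / (1 - p) \<le> J y"
      using value_le[OF w] p_less_1 by (simp add: field_simps)
  qed
  then show ?thesis using p_less_1 by (simp add: step_value_def field_simps)
qed

text \<open>The minimum over the finitely many successors is attained and lies below
  \<open>J y\<close> for every path \<open>y\<close> from \<open>x\<close>, hence below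
  \<open>V x\<close>.\<close>

lemma optimal_successor_exists:
  assumes "x \<in> X"
  shows "\<exists>u\<in>N x. step_value x u = V x"
proof -
  have fin: "finite (step_value x ` N x)" "step_value x ` N x \<noteq> {}"
    using neighbours[OF assms] finite_nodes self_neighbour[OF assms]
    by (auto intro: finite_subset)
  have "Min (step_value x ` N x) \<le> V x"
  proof (rule value_greatest[OF assms])
    fix y assume y: "y \<in> paths_from X N x"
    have "y 1 \<in> N x" using paths_fromD(1)[OF y] paths_fromD(3)[OF y, of 0] by simp
    then have "Min (step_value x ` N x) \<le> step_value x (y 1)" using fin by simp
    also have "\<dots> \<le> J y"
      using expected_cost_step[OF y] value_le[OF tail_in_paths_from[OF y]] p_less_1
      by (simp add: step_value_def)
    finally show "Min (step_value x ` N x) \<le> J y" .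
  qed
  moreover obtain u where "u \<in> N x" "Min (step_value x ` N x) = step_value x u"
    using Min_in[OF fin] by auto
  ultimately show ?thesis using value_le_step[OF assms, of u] by force
qed

section \<open>The value along optimal paths\<close>

lemma optimal_step:
  assumes "optimal x y"
  shows "optimal (y 1) (y \<circ> Suc)" "V x = step_value x (y 1)"
proof -
  have y: "y \<in> paths_from X N x" and opt: "J y = V x"
    using assms by (auto simp: optimal_path_def)
  have "x \<in> X" "y 1 \<in> N x"
    using paths_fromD(1)[OF y] paths_fromD(2,3)[OF y, of 0] by auto
  \<comment> \<open>Since \<open>J y = V x \<le> step_value x (y 1)\<close>, cancelling the common
    terms leaves no room for a suboptimal tail.\<close>
  then have "(1 - p) * J (y \<circ> Suc) \<le> (1 - p) * V (y 1)"
    using value_le_step expected_cost_step[OF y] opt by (force simp: step_value_def)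
  then have eq: "J (y \<circ> Suc) = V (y 1)"
    using p_less_1 value_le[OF tail_in_paths_from[OF y]] by auto
  then show "optimal (y 1) (y \<circ> Suc)" "V x = step_value x (y 1)"
    using tail_in_paths_from[OF y] expected_cost_step[OF y] opt
    by (auto simp: optimal_path_def step_value_def)
qed

lemma optimal_tail: "optimal x y \<Longrightarrow> optimal (y k) (\<lambda>n. y (k + n))"
proof (induction k)
  case 0
  then show ?case by (auto simp: optimal_path_def paths_from_def)
next
  case (Suc k)
  then show ?case using optimal_step(1)[of "y k" "\<lambda>n. y (k + n)"] by (simp add: comp_def)
qed

lemma optimal_value_step: "optimal x y \<Longrightarrow> V (y k) = step_value (y k) (y (Suc k))"
  using optimal_step(2)[OF optimal_tail, of x y k] by simp

lemma value_ge_successor: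
  assumes "optimal x y"
  shows "V (y (Suc k)) + K (y k) (y (Suc k)) \<le> V (y k)"
proof -
  \<comment> \<open>Lowering \<open>q\<close> to \<open>V\<close> turns
    \<open>p * q + (1 - p) * V\<close> at the next node into \<open>V\<close>.\<close>
  have "p * V (y (Suc k)) \<le> p * q (y (Suc k))"
    using assms p_pos by (intro mult_left_mono value_le_terminal)
      (auto simp: optimal_path_def dest: paths_fromD)
  then show ?thesis
    using optimal_value_step[OF assms, of k] by (simp add: step_value_def algebra_simps)
qed

lemma optimal_K_nonneg: "optimal x y \<Longrightarrow> 0 \<le> K (y k) (y (Suc k))"
  by (auto simp: optimal_path_def intro!: K_nonneg dest: paths_fromD)

lemma value_antimono_optimal:
  assumes "optimal x y"
  shows "antimono (\<lambda>k. V (y k))"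
proof (intro decseq_SucI)
  fix k
  show "V (y (Suc k)) \<le> V (y k)"
    using value_ge_successor[OF assms, of k] optimal_K_nonneg[OF assms, of k] by linarith
qed

text \<open>Without a decrease of \<open>V\<close>, the weight \<open>p\<close> on \<open>q\<close>
  in the Bellman equation forces \<open>q \<le> V\<close> at the node reached.\<close>

lemma value_eq_terminal_if_no_decrease:
  assumes opt: "optimal x y" and le: "V (y k) \<le> V (y (Suc k))"
  shows "V (y (Suc k)) = q (y (Suc k))"
proof -
  have "K (y k) (y (Suc k)) + p * q (y (Suc k)) \<le> p * V (y (Suc k))"
    using optimal_value_step[OF opt, of k] le by (simp add: step_value_def algebra_simps)
  then have "p * q (y (Suc k)) \<le> p * V (y (Suc k))"
    using optimal_K_nonneg[OF opt, of k] by linarith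
  moreover have "V (y (Suc k)) \<le> q (y (Suc k))"
    using opt by (intro value_le_terminal) (auto simp: optimal_path_def dest: paths_fromD)
  ultimately show ?thesis using p_pos by simp
qed

lemma value_eq_terminal_on_plateau:
  assumes opt: "optimal x y" and le: "V (y a) \<le> V (y b)" and k: "a < k" "k \<le> b"
  shows "V (y k) = q (y k)"
proof -
  obtain j where j: "k = Suc j" "a \<le> j" using k(1) by (cases k) auto
  \<comment> \<open>The chain \<open>V (y j) \<le> V (y a) \<le> V (y b) \<le> V (y k)\<close> shows
    that the step from \<open>j\<close> to \<open>k\<close> brings no decrease.\<close>
  have "V (y j) \<le> V (y a)" "V (y b) \<le> V (y k)"
    using value_antimono_optimal[OF opt] j(2) k(2) by (auto dest: antimonoD)
  then show ?thesis using value_eq_terminal_if_no_decrease[OF opt, of j] le j(1) by simp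
qed

text \<open>Telescopes \<open>value_ge_successor\<close>. The bound \<open>\<Delta>\<close> is
  assumed step by step because motionless steps cost 0.\<close>

lemma value_ge_steps:
  assumes opt: "optimal x y" and K: "\<And>l. l < k \<Longrightarrow> \<Delta> \<le> K (y l) (y (Suc l))"
  shows "real k * \<Delta> + V (y k) \<le> V x"
  using K
proof (induction k)
  case 0
  then show ?case using opt paths_fromD(1) by (force simp: optimal_path_def)
next
  case (Suc k)
  have "real k * \<Delta> + V (y k) \<le> V x" "\<Delta> \<le> K (y k) (y (Suc k))" using Suc by auto
  then show ?case using value_ge_successor[OF opt, of k] by (simp add: algebra_simps)
qed

section \<open>Greedy paths: simple, optimal, eventually motionless\<close>

definition successor :: "'a \<Rightarrow> 'a" where
  "successor x = (if V x = q x then x else SOME u. u \<in> N x \<and> step_value x u = V x)"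

lemma successor:
  assumes "x \<in> X"
  shows "successor x \<in> N x" "step_value x (successor x) = V x"
proof -
  have "successor x \<in> N x \<and> step_value x (successor x) = V x"
  proof (cases "V x = q x")
    case True
    \<comment> \<open>Staying put attains the value here: \<open>K x x = 0\<close> and
      \<open>p * q x + (1 - p) * V x = V x\<close>.\<close>
    then show ?thesis
      using assms self_neighbour K_self by (simp add: successor_def step_value_def algebra_simps)
  next
    case False
    then show ?thesis
      using someI_ex[of "\<lambda>u. u \<in> N x \<and> step_value x u = V x"] optimal_successor_exists[OF assms]
      unfolding successor_def by auto
  qed
  then show "successor x \<in> N x" "step_value x (successor x) = V x" by auto
qed

definition greedy_path :: "'a \<Rightarrow> nat \<Rightarrow> 'a" where
  "greedy_path x k = (successor ^^ k) x"

lemma successor_in: "x \<in> X \<Longrightarrow> successor x \<in> X"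
  using successor(1) neighbours by blast

lemma greedy_path_in_paths_from:
  assumes "x \<in> X"
  shows "greedy_path x \<in> paths_from X N x"
proof -
  have "greedy_path x k \<in> X" for k
    unfolding greedy_path_def by (induction k) (auto simp: assms successor_in)
  then show ?thesis
    using successor(1) by (auto simp: paths_from_def is_path_def greedy_path_def)
qed

lemma greedy_path_tail: "greedy_path x \<circ> Suc = greedy_path (successor x)"
  unfolding greedy_path_def comp_def funpow_Suc_right ..

text \<open>The next node is a function of the current node alone.\<close>

lemma simple_greedy_path: "simple_path (greedy_path x)"
  by (simp add: simple_path_def greedy_path_def)

text \<open>
  The excess \<open>J - V\<close> of the greedy path shrinks by the factor \<open>1 - p\<close> at each step, so its maximum
  over the finite node set cannot be positive.
\<close>

lemma optimal_greedy_path: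
  assumes "x \<in> X"
  shows "optimal x (greedy_path x)"
proof -
  define D where "D x = J (greedy_path x) - V x" for x
  have D_step: "D x = (1 - p) * D (successor x)" if "x \<in> X" for x
    using expected_cost_step[OF greedy_path_in_paths_from[OF that]] successor(2)[OF that]
    unfolding D_def greedy_path_tail
    by (simp add: greedy_path_def step_value_def algebra_simps)
  have fin: "finite (D ` X)" "D ` X \<noteq> {}" using finite_nodes assms by auto
  then obtain m where m: "m \<in> X" "Max (D ` X) = D m"
    using Max_in[OF fin] by (metis imageE)
  have "D (successor m) \<le> D m" using fin m successor_in by (metis Max_ge imageI)
  then have "(1 - p) * D (successor m) \<le> (1 - p) * D m"
    using p_less_1 by (intro mult_left_mono) auto
  then have "D m \<le> (1 - p) * D m" unfolding D_step[OF m(1), symmetric] .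
  then have "p * D m \<le> 0" by (simp add: algebra_simps)
  then have "D m \<le> 0" using p_pos by (simp add: mult_le_0_iff)
  then have "D x \<le> 0" using fin m assms by (metis Max_ge imageI order_trans)
  then show ?thesis
    using greedy_path_in_paths_from[OF assms] value_le[OF greedy_path_in_paths_from[OF assms]]
    by (simp add: D_def optimal_path_def)
qed

text \<open>Nodes with \<open>V = q\<close> are fixed points of \<open>successor\<close>.\<close>

lemma greedy_path_stops:
  assumes "V (greedy_path x m) = q (greedy_path x m)" "m \<le> k"
  shows "greedy_path x k = greedy_path x m"
  using assms(2)
proof (induction k rule: dec_induct)
  case (step k)
  then show ?case using assms(1) by (simp add: greedy_path_def successor_def)
qed simp

lemma eventually_motionless_greedy_path:
  assumes "x \<in> X"
  shows "eventually_motionless (greedy_path x)"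
proof -
  have "range (greedy_path x) \<subseteq> X"
    using paths_fromD(2)[OF greedy_path_in_paths_from[OF assms]] by auto
  then have "\<not> inj (greedy_path x)"
    using finite_nodes finite_subset finite_imageD infinite_UNIV_nat by metis
  then obtain a b where "a < b" "greedy_path x a = greedy_path x b"
    by (metis injI linorder_neqE_nat)
  \<comment> \<open>The revisit makes \<open>V\<close> equal at \<open>a\<close> and
    \<open>b\<close>, so \<open>b\<close> itself lies on a plateau.\<close>
  then have "V (greedy_path x b) = q (greedy_path x b)"
    using value_eq_terminal_on_plateau[OF optimal_greedy_path[OF assms], of a b b] by simp
  then show ?thesis
    unfolding eventually_motionless_def using greedy_path_stops by blast
qed

section \<open>Optimal loops and avoidance of earlier nodes\<close>

lemma optimal_loop_value:
  assumes opt: "optimal (y 0) y" and loop: "is_loop y m" and k: "k \<le> m"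
  shows "V (y k) = q (y k)" "q (y k) = q (y 0)"
proof -
  have "y (Suc m) = y 0" using loop unfolding is_loop_def by (metis add_0)
  then have le: "V (y 0) \<le> V (y (Suc m))" by simp
  have eq: "V (y j) = q (y j)" if "j \<le> m" for j
  proof (cases j)
    \<comment> \<open>The plateau lemma excludes its left end, so \<open>y 0\<close> is treated as
      \<open>y (Suc m)\<close>.\<close>
    case 0
    then show ?thesis
      using value_eq_terminal_on_plateau[OF opt le, of "Suc m"] \<open>y (Suc m) = y 0\<close> by simp
  next
    case (Suc i)
    then show ?thesis using value_eq_terminal_on_plateau[OF opt le] that by simp
  qed
  have "V (y k) \<le> V (y 0)" "V (y (Suc m)) \<le> V (y k)"
    using antimonoD[OF value_antimono_optimal[OF opt], of 0 k]
      antimonoD[OF value_antimono_optimal[OF opt], of k "Suc m"] k by auto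
  then show "V (y k) = q (y k)" "q (y k) = q (y 0)"
    using eq[OF k] eq[of 0] le by auto
qed

text \<open>
  If \<open>z\<close> is reached optimally from \<open>x\<close> and \<open>x\<close> from \<open>z\<close>, then \<open>V\<close> is constant on the way from \<open>x\<close> to
  \<open>z\<close>, so stopping at \<open>z\<close> is optimal and the greedy path from \<open>z\<close> never leaves it.
\<close>

lemma greedy_path_avoids:
  assumes opt: "optimal x y" and z: "y k = z" "z \<noteq> x"
  shows "greedy_path z n \<noteq> x"
proof
  assume n: "greedy_path z n = x"
  have x: "y 0 = x" "z \<in> X" using opt z(1) by (auto simp: optimal_path_def dest: paths_fromD)
  have "V (greedy_path z n) \<le> V (greedy_path z 0)"
    using value_antimono_optimal[OF optimal_greedy_path[OF x(2)]] by (auto dest: antimonoD)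
  then have le: "V (y 0) \<le> V (y k)" using n x(1) z(1) by (simp add: greedy_path_def)
  have "0 < k" using x(1) z by (cases k) auto
  then have "V z = q z" using value_eq_terminal_on_plateau[OF opt le, of k] z(1) by simp
  then have "greedy_path z n = z" using greedy_path_stops[of z 0 n] by (simp add: greedy_path_def)
  then show False using n z(2) by simp
qed

end

text \<open>The disjunction on \<open>\<Delta>\<close> in the second part excludes motionless steps
  when \<open>\<Delta> > 0\<close>: an optimal constant path would violate the bound for every
  \<open>k > 0\<close>.\<close>

theorem theorem2p3:
  fixes X :: "'a set" and N :: "'a \<Rightarrow> 'a set"
    and K :: "'a \<Rightarrow> 'a \<Rightarrow> real" and q :: "'a \<Rightarrow> real" and p \<Delta> :: real
  assumes finite_nodes: "finite X"
    and neighbours: "\<forall>x\<in>X. N x \<subseteq> X"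
    and p_range: "0 < p" "p < 1"
    and A1: "\<forall>x\<in>X. x \<in> N x"
    and A2: "\<forall>x\<in>X. K x x = 0"
    and A3: "\<Delta> \<ge> 0" "\<forall>x\<in>X. \<forall>y\<in>N x. y \<noteq> x \<longrightarrow> K x y \<ge> \<Delta>"
  shows "(\<forall>x\<in>X. value_fn X N p K q x \<le> q x) \<and>
    (\<forall>x\<in>X. \<forall>z\<in>X. \<forall>y k.
       optimal_path X N p K q x y \<and> simple_path y \<and> y k = z \<and>
       (\<Delta> = 0 \<or> (\<forall>l<k. y (Suc l) \<noteq> y l)) \<longrightarrow>
       value_fn X N p K q x \<ge> real k * \<Delta> + value_fn X N p K q z) \<and>
    (\<forall>y m.
       optimal_path X N p K q (y 0) y \<and> is_loop y m \<longrightarrow>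
       (\<forall>k\<le>m. value_fn X N p K q (y k) = q (y k) \<and> q (y k) = q (y 0))) \<and>
    (\<forall>x\<in>X. \<exists>y. optimal_path X N p K q x y \<and> simple_path y \<and> eventually_motionless y) \<and>
    (\<forall>x\<in>X. \<forall>z\<in>X. z \<noteq> x \<longrightarrow>
       (\<exists>y. optimal_path X N p K q x y \<and> eventually_motionless y \<and> (\<exists>k. y k = z)) \<longrightarrow>
       (\<exists>w. optimal_path X N p K q z w \<and> eventually_motionless w \<and> (\<forall>k. w k \<noteq> x)))"
proof -
  interpret random_termination X N K q p
  proof
    fix x u assume "x \<in> X" "u \<in> N x"
    then show "0 \<le> K x u" using A2 A3 by (cases "u = x") force+
  qed (use finite_nodes neighbours p_range A1 A2 in auto)
  show ?thesis
  proof (intro conjI)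
    show "\<forall>x\<in>X. V x \<le> q x" by (intro ballI value_le_terminal)
    show "\<forall>x\<in>X. \<forall>z\<in>X. \<forall>y k. optimal x y \<and> simple_path y \<and> y k = z \<and>
        (\<Delta> = 0 \<or> (\<forall>l<k. y (Suc l) \<noteq> y l)) \<longrightarrow> V x \<ge> real k * \<Delta> + V z"
    proof (intro ballI allI impI, elim conjE)
      fix x z y k
      assume opt: "optimal x y" and z: "y k = z"
        and moves: "\<Delta> = 0 \<or> (\<forall>l<k. y (Suc l) \<noteq> y l)"
      have "\<Delta> \<le> K (y l) (y (Suc l))" if "l < k" for l
      proof -
        have "y l \<in> X" "y (Suc l) \<in> N (y l)"
          using opt by (auto simp: optimal_path_def dest: paths_fromD)
        \<comment> \<open>For \<open>\<Delta> = 0\<close> this is nonnegativity of the costs;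
          otherwise the step moves and (A3) applies.\<close>
        then show ?thesis
          using moves that A3(2) optimal_K_nonneg[OF opt, of l] by auto
      qed
      then show "V x \<ge> real k * \<Delta> + V z"
        using value_ge_steps[OF opt, of k \<Delta>] z by simp
    qed
    show "\<forall>y m. optimal (y 0) y \<and> is_loop y m \<longrightarrow>
        (\<forall>k\<le>m. V (y k) = q (y k) \<and> q (y k) = q (y 0))"
      using optimal_loop_value by blast
    show "\<forall>x\<in>X. \<exists>y. optimal x y \<and> simple_path y \<and> eventually_motionless y"
      using optimal_greedy_path simple_greedy_path eventually_motionless_greedy_path by blast
    show "\<forall>x\<in>X. \<forall>z\<in>X. z \<noteq> x \<longrightarrow>
        (\<exists>y. optimal x y \<and> eventually_motionless y \<and> (\<exists>k. y k = z)) \<longrightarrow>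
        (\<exists>w. optimal z w \<and> eventually_motionless w \<and> (\<forall>k. w k \<noteq> x))"
    proof (intro ballI impI, elim exE conjE)
      fix x z y k assume "z \<in> X" "z \<noteq> x" "optimal x y" "y k = z"
      then show "\<exists>w. optimal z w \<and> eventually_motionless w \<and> (\<forall>k. w k \<noteq> x)"
        using optimal_greedy_path eventually_motionless_greedy_path greedy_path_avoids
        by (intro exI[of _ "greedy_path z"]) blast
    qed
  qed
qed

end
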